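(* Let $\mathbb{A}$ be a cellular algebra over a field $\mathbb{F}$ with a decomposition $1_{\mathbb{A}}=\sum_{i\in I}e_i$ satisfying (A1)–(A4). Then $\mathbb{A}$ is semisimple if and only if $e_i\mathbb{A}e_i$ is semisimple for every $i\in I$.
   Context: A cellular algebra over a field $\mathbb{F}$ is an associative unital $\mathbb{F}$-algebra $\mathbb{A}$ with a tuple $(\Lambda,T(\cdot),\mathsf{C},* )$ such that: $\Lambda$ is a finite poset; for each $\lambda\in\Lambda$, $T(\lambda)$ is a nonempty finite set and for $s,t\in T(\lambda)$ there is $c^\lambda_{st}\in\mathbb{A}$, with $\mathsf{C}=\{c^\lambda_{st}\}$ an $\mathbb{F}$-basis of $\mathbb{A}$; $*$ is an $\mathbb{F}$-linear anti-automorphism with $*^2=\mathrm{id}$ and $(c^\lambda_{st})^*=c^\lambda_{ts}$; and for $a\in\mathbb{A}$, $a c^\lambda_{st}\equiv\sum_{u\in T(\lambda)}r_a^{(u,s)}c^\lambda_{ut}\mod \mathbb{A}^{>\lambda}$ with $r_a^{(u,s)}\in\mathbb{F}$ depending only on $a,u,s$, where $\mathbb{A}^{>\lambda}$ is the span of basis elements $c^\mu_{xy}$ with $\mu>\lambda$. Assumptions: (A1) $I$ is a finite set; (A2) $1_{\mathbb{A}}=\sum_{i\in I}e_i$ with $e_i\neq 0$, $e_i^2=e_i$, $e_ie_j=0$ for $i\neq j$; (A3) for each $\lambda\in\Lambda$ and $t\in T(\lambda)$ there is $i\in I$ with $e_ic^\lambda_{ts}=c^\lambda_{ts}$ for all $s\in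 T(\lambda)$; (A4) $e_i^*=e_i$ for all $i$. *)

theory Defs
  imports Complex_Main
begin

definition f_algebra :: "('k::field \<Rightarrow> 'a::ring_1 \<Rightarrow> 'a) \<Rightarrow> bool" where
  "f_algebra scale \<longleftrightarrow> Vector_Spaces.vector_space scale \<and>
     (\<forall>c x y. scale c (x * y) = scale c x * y \<and> scale c (x * y) = x * scale c y)"

definition left_ideal_in :: "'a::ring_1 set \<Rightarrow> 'a set \<Rightarrow> bool" where
  "left_ideal_in R L \<longleftrightarrow> L \<subseteq> R \<and> 0 \<in> L \<and> (\<forall>x\<in>L. \<forall>y\<in>L. x + y \<in> L) \<and>
     (\<forall>x\<in>L. - x \<in> L) \<and> (\<forall>r\<in>R. \<forall>x\<in>L. r * x \<in> L)"

text \<open>Semisimple ring (on carrier R): the left regular module is semisimple,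
  i.e. every left ideal is a direct summand (has a complementary left ideal).\<close>

definition semisimple_ring_on :: "'a::ring_1 set \<Rightarrow> bool" where
  "semisimple_ring_on R \<longleftrightarrow>
     (\<forall>L. left_ideal_in R L \<longrightarrow>
        (\<exists>L'. left_ideal_in R L' \<and> L \<inter> L' = {0} \<and> {x + y | x y. x \<in> L \<and> y \<in> L'} = R))"

definition corner :: "'a::ring_1 \<Rightarrow> 'a set" where
  "corner e = {e * x * e | x. True}"

definition higher_span ::
  "('k::field \<Rightarrow> 'a::ring_1 \<Rightarrow> 'a) \<Rightarrow> 'l rel \<Rightarrow> 'l set \<Rightarrow> ('l \<Rightarrow> 't set) \<Rightarrow>
   ('l \<Rightarrow> 't \<Rightarrow> 't \<Rightarrow> 'a) \<Rightarrow> 'l \<Rightarrow> 'a set" where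
  "higher_span scale po \<Lambda> T c la =
     module.span scale {c \<mu> x y | \<mu> x y. \<mu> \<in> \<Lambda> \<and> (la, \<mu>) \<in> po \<and> \<mu> \<noteq> la \<and> x \<in> T \<mu> \<and> y \<in> T \<mu>}"

text \<open>Cellular algebra datum (Lambda, T, C, star) for the F-algebra 'a.
  The poset is (Lambda, po); mu > lambda means (lambda, mu) in po and mu \<noteq> lambda.\<close>

definition cellular_algebra ::
  "('k::field \<Rightarrow> 'a::ring_1 \<Rightarrow> 'a) \<Rightarrow> 'l rel \<Rightarrow> 'l set \<Rightarrow> ('l \<Rightarrow> 't set) \<Rightarrow>
   ('l \<Rightarrow> 't \<Rightarrow> 't \<Rightarrow> 'a) \<Rightarrow> ('a \<Rightarrow> 'a) \<Rightarrow> bool" where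
  "cellular_algebra scale po \<Lambda> T c star \<longleftrightarrow>
     f_algebra scale \<and>
     finite \<Lambda> \<and> partial_order_on \<Lambda> po \<and>
     (\<forall>la\<in>\<Lambda>. finite (T la) \<and> T la \<noteq> {}) \<and>
     \<comment> \<open>C is a basis (indexed family: injective, independent, spanning)\<close>
     inj_on (\<lambda>(la, s, t). c la s t) {(la, s, t). la \<in> \<Lambda> \<and> s \<in> T la \<and> t \<in> T la} \<and>
     \<not> module.dependent scale {c la s t | la s t. la \<in> \<Lambda> \<and> s \<in> T la \<and> t \<in> T la} \<and>
     module.span scale {c la s t | la s t. la \<in> \<Lambda> \<and> s \<in> T la \<and> t \<in> T la} = UNIV \<and>
     \<comment> \<open>star is an F-linear anti-automorphism of order two\<close>
     (\<forall>x y. star (x + y) = star x + star y) \<and>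
     (\<forall>a x. star (scale a x) = scale a (star x)) \<and>
     (\<forall>x y. star (x * y) = star y * star x) \<and>
     (\<forall>x. star (star x) = x) \<and>
     (\<forall>la\<in>\<Lambda>. \<forall>s\<in>T la. \<forall>t\<in>T la. star (c la s t) = c la t s) \<and>
     \<comment> \<open>multiplication rule modulo A^{>lambda}, coefficients independent of t\<close>
     (\<forall>a. \<forall>la\<in>\<Lambda>. \<forall>s\<in>T la. \<exists>r :: 't \<Rightarrow> 'k. \<forall>t\<in>T la.
        a * c la s t - (\<Sum>u\<in>T la. scale (r u) (c la u t)) \<in> higher_span scale po \<Lambda> T c la)"

end

theory Submission
  imports Defs
begin

text \<open>
  If every left ideal of \<open>A\<close> has a right unit, so does every left ideal of a corner of \<open>A\<close>.
  For the converse, a finite-dimensional algebra is semisimple once \<open>x A x = 0\<close> forces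
  \<open>x = 0\<close>, and this can be tested on the Peirce components \<open>x = e\<^sub>j x e\<^sub>k\<close>. At a minimal
  cell \<open>\<lambda>\<close> in the support of \<open>x\<close>, either some left multiple of \<open>x\<close> is nonzero and can be moved
  into the corner at \<open>k\<close>, or a column of \<open>x\<close> gives a vector in the radical of the cell form of the
  corner at \<open>j\<close>; both contradict semisimplicity of that corner.
\<close>

section \<open>Semisimple corners\<close>

lemma corner_iff:
  fixes e :: "'a::ring_1"
  assumes "e * e = e"
  shows "x \<in> corner e \<longleftrightarrow> e * x = x \<and> x * e = x"
proof
  assume "x \<in> corner e"
  then obtain y where y: "x = e * y * e" by (auto simp: corner_def)
  have "e * x = (e * e) * y * e" "x * e = e * y * (e * e)" by (simp_all add: y mult.assoc)
  then show "e * x = x \<and> x * e = x" by (simp add: y assms)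
next
  assume "e * x = x \<and> x * e = x"
  then have "x = e * x * e" by simp
  then show "x \<in> corner e" unfolding corner_def by blast
qed

lemma corner_one: "corner (1::'a::ring_1) = UNIV"
  by (auto simp: corner_def)

lemma left_ideal_in_diff:
  "left_ideal_in R L \<Longrightarrow> x \<in> L \<Longrightarrow> y \<in> L \<Longrightarrow> x - y \<in> L"
  unfolding left_ideal_in_def by (metis diff_conv_add_uminus)

text \<open>Split the unit as \<open>e = p + q\<close> along \<open>L\<close> and a complement
  \<open>L'\<close>. For \<open>x\<close> in \<open>L\<close>, the element
  \<open>x * q = x - x * p\<close> lies in both left ideals, so it vanishes and \<open>p\<close> is
  the right unit.\<close>

lemma semisimple_corner_right_unit:
  fixes e :: "'a::ring_1"
  assumes e: "e * e = e" and ss: "semisimple_ring_on (corner e)"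
    and L: "left_ideal_in (corner e) L"
  obtains f where "f \<in> L" "\<And>x. x \<in> L \<Longrightarrow> x * f = x"
proof -
  obtain L' where L': "left_ideal_in (corner e) L'" and inter: "L \<inter> L' = {0}"
    and sum: "{x + y | x y. x \<in> L \<and> y \<in> L'} = corner e"
    using ss[unfolded semisimple_ring_on_def, rule_format, OF L] by (elim exE conjE)
  have "e \<in> corner e" by (simp add: corner_iff e)
  then obtain p q where p: "p \<in> L" and q: "q \<in> L'" and pq: "e = p + q"
    using sum by blast
  have "x * p = x" if x: "x \<in> L" for x
  proof -
    have xR: "x \<in> corner e" using L x by (auto simp: left_ideal_in_def)
    then have "x * q = x - x * p"
      using pq by (metis add_diff_cancel_left' corner_iff distrib_left e)
    moreover have "x * p \<in> L" using L xR p by (auto simp: left_ideal_in_def)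
    ultimately have "x * q \<in> L" using left_ideal_in_diff[OF L x] by simp
    moreover have "x * q \<in> L'" using L' xR q by (auto simp: left_ideal_in_def)
    ultimately have "x * q = 0" using inter by blast
    then show ?thesis using \<open>x * q = x - x * p\<close> by simp
  qed
  with p show thesis by (rule that)
qed

text \<open>A right unit \<open>f\<close> of \<open>L\<close> is an idempotent, and the splitting
  \<open>y = y * f + (y - y * f)\<close> shows that its left annihilator in the corner complements
  \<open>L\<close>.\<close>

lemma semisimple_cornerI:
  fixes e :: "'a::ring_1"
  assumes e: "e * e = e"
    and unit: "\<And>L. left_ideal_in (corner e) L \<Longrightarrow> \<exists>f\<in>L. \<forall>x\<in>L. x * f = x"
  shows "semisimple_ring_on (corner e)"
  unfolding semisimple_ring_on_def
proof (intro allI impI)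
  fix L assume L: "left_ideal_in (corner e) L"
  then obtain f where f: "f \<in> L" "\<forall>x\<in>L. x * f = x" using unit by blast
  have LR: "L \<subseteq> corner e" using L by (auto simp: left_ideal_in_def)
  define L' where "L' = {y \<in> corner e. y * f = 0}"
  have "left_ideal_in (corner e) L'"
    unfolding left_ideal_in_def L'_def
    by (auto simp: corner_iff[OF e] algebra_simps) (metis mult.assoc)
  moreover have "L \<inter> L' = {0}"
    using f L by (auto simp: L'_def corner_iff[OF e] left_ideal_in_def)
  moreover have "{x + y | x y. x \<in> L \<and> y \<in> L'} = corner e"
  proof
    show "{x + y | x y. x \<in> L \<and> y \<in> L'} \<subseteq> corner e"
      using LR by (fastforce simp: L'_def corner_iff[OF e] algebra_simps)
  next
    show "corner e \<subseteq> {x + y | x y. x \<in> L \<and> y \<in> L'}"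
    proof
      fix y assume y: "y \<in> corner e"
      have yf: "y * f \<in> L" using L y f by (auto simp: left_ideal_in_def)
      have "y - y * f \<in> corner e"
        using y yf LR by (auto simp: corner_iff[OF e] algebra_simps)
      moreover have "(y - y * f) * f = 0"
        using f by (simp add: left_diff_distrib mult.assoc)
      ultimately have "y - y * f \<in> L'" by (simp add: L'_def)
      moreover have "y = y * f + (y - y * f)" by simp
      ultimately show "y \<in> {x + y | x y. x \<in> L \<and> y \<in> L'}" using yf by blast
    qed
  qed
  ultimately show "\<exists>L'. left_ideal_in (corner e) L' \<and> L \<inter> L' = {0} \<and>
      {x + y | x y. x \<in> L \<and> y \<in> L'} = corner e" by blast
qed

text \<open>The set \<open>J\<close> is the largest left ideal of the whole algebra that has
  \<open>e\<close> as a right unit and is carried into \<open>L\<close> by left multiplication with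
  \<open>e\<close>. It contains \<open>L\<close>, so a right unit \<open>p\<close> of
  \<open>J\<close>, cut down to \<open>e * p\<close>, is a right unit of \<open>L\<close>.\<close>

lemma semisimple_corner_of_semisimple:
  fixes e :: "'a::ring_1"
  assumes e: "e * e = e" and ss: "semisimple_ring_on (UNIV :: 'a set)"
  shows "semisimple_ring_on (corner e)"
proof (rule semisimple_cornerI[OF e])
  fix L assume L: "left_ideal_in (corner e) L"
  define J where "J = {a. a * e = a \<and> (\<forall>r. e * r * a \<in> L)}"
  have J: "left_ideal_in (corner 1) J"
    unfolding left_ideal_in_def corner_one
  proof (intro conjI ballI)
    fix r x assume x: "x \<in> J"
    have "e * s * (r * x) \<in> L" for s
    proof -
      have "e * (s * r) * x \<in> L" using x by (simp add: J_def)
      then show ?thesis by (simp add: mult.assoc)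
    qed
    then show "r * x \<in> J" using x by (simp add: J_def) (simp add: mult.assoc)
  qed (use L in \<open>auto simp: J_def left_ideal_in_def distrib_left distrib_right\<close>)
  have "L \<subseteq> J"
  proof
    fix a assume a: "a \<in> L"
    then have a': "e * a = a" "a * e = a" using L by (auto simp: left_ideal_in_def corner_iff[OF e])
    have "e * r * a = (e * r * e) * a" for r using a' by (simp add: mult.assoc)
    moreover have "e * r * e \<in> corner e" for r by (auto simp: corner_def)
    ultimately show "a \<in> J" using L a a' by (auto simp: J_def left_ideal_in_def)
  qed
  obtain p where p: "p \<in> J" "\<And>x. x \<in> J \<Longrightarrow> x * p = x"
    using semisimple_corner_right_unit[of 1 J] ss J by (auto simp: corner_one)
  have "e * p \<in> L" using p(1) by (simp add: J_def) (metis mult_1_right)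
  moreover have "x * (e * p) = x" if "x \<in> L" for x
    using that \<open>L \<subseteq> J\<close> p(2)[of x] by (auto simp: J_def mult.assoc[symmetric])
  ultimately show "\<exists>f\<in>L. \<forall>x\<in>L. x * f = x" by blast
qed

text \<open>The left ideal of the corner generated by \<open>z\<close> has a right unit of the form
  \<open>b * z\<close>, whence \<open>z = z * b * z = 0\<close>.\<close>

lemma semisimple_corner_semiprime:
  fixes e :: "'a::ring_1"
  assumes e: "e * e = e" and ss: "semisimple_ring_on (corner e)"
    and z: "z \<in> corner e" and zz: "\<And>a. z * a * z = 0"
  shows "z = 0"
proof -
  define L where "L = {b * z | b. b \<in> corner e}"
  have ez: "e * z = z" "z * e = z" using z by (auto simp: corner_iff[OF e])
  have L: "left_ideal_in (corner e) L"
    unfolding left_ideal_in_def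
  proof (intro conjI ballI)
    show "L \<subseteq> corner e" using ez by (auto simp: L_def corner_iff[OF e] mult.assoc) (metis mult.assoc)
    show "0 \<in> L" unfolding L_def by (auto simp: corner_iff[OF e] intro!: exI[of _ 0])
    fix x assume "x \<in> L"
    then obtain b where b: "x = b * z" "b \<in> corner e" by (auto simp: L_def)
    have "- x = (- b) * z" "- b \<in> corner e" using b by (auto simp: corner_iff[OF e])
    then show "- x \<in> L" unfolding L_def by blast
    { fix y assume "y \<in> L"
      then obtain b' where b': "y = b' * z" "b' \<in> corner e" by (auto simp: L_def)
      have "x + y = (b + b') * z" "b + b' \<in> corner e"
        using b b' by (auto simp: corner_iff[OF e] algebra_simps)
      then show "x + y \<in> L" unfolding L_def by blast }
    { fix r assume "r \<in> corner e"
      then have "r * x = (r * b) * z" "r * b \<in> corner e"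
        using b by (auto simp: corner_iff[OF e] mult.assoc) (metis mult.assoc)
      then show "r * x \<in> L" unfolding L_def by blast }
  qed
  obtain f where f: "f \<in> L" "\<And>x. x \<in> L \<Longrightarrow> x * f = x"
    using semisimple_corner_right_unit[OF e ss L] by blast
  have "e \<in> corner e" by (simp add: corner_iff e)
  then have "z \<in> L" using ez(1) unfolding L_def by force
  moreover obtain b where "f = b * z" using f(1) by (auto simp: L_def)
  ultimately show ?thesis using f(2) zz[of b] by (metis mult.assoc)
qed

section \<open>Semiprime finite-dimensional algebras\<close>

locale fin_dim_algebra = finite_dimensional_vector_space scale B
  for scale :: "'k::field \<Rightarrow> 'a::ring_1 \<Rightarrow> 'a" and B +
  assumes alg: "f_algebra scale"
begin

lemma scale_mult_left: "scale k x * y = scale k (x * y)"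
  and scale_mult_right: "x * scale k y = scale k (x * y)"
  using alg unfolding f_algebra_def by metis+

text \<open>Scaling by \<open>k\<close> is left multiplication by \<open>scale k 1\<close>.
  Dimension counts therefore apply to left ideals, although \<open>left_ideal_in\<close> mentions no
  scalars.\<close>

lemma subspace_left_ideal: "left_ideal_in UNIV L \<Longrightarrow> subspace L"
  unfolding left_ideal_in_def subspace_def
  by (metis UNIV_I mult_1 scale_mult_left)

lemma left_ideal_eq_if_dim_le:
  assumes "left_ideal_in UNIV L" "left_ideal_in UNIV K" "K \<subseteq> L" "dim L \<le> dim K"
  shows "K = L"
  using assms subspace_left_ideal subspace_dim_equal by blast

lemma minimal_left_ideal:
  fixes L :: "'a set"
  assumes "left_ideal_in UNIV L" "L \<noteq> {0}"
  obtains K where "left_ideal_in UNIV K" "K \<noteq> {0}" "K \<subseteq> L"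
    "\<And>M. left_ideal_in UNIV M \<Longrightarrow> M \<subseteq> K \<Longrightarrow> M \<noteq> {0} \<Longrightarrow> M = K"
proof -
  let ?P = "\<lambda>K. left_ideal_in UNIV K \<and> K \<noteq> {0} \<and> K \<subseteq> L"
  obtain K where K: "?P K" "\<And>M. ?P M \<Longrightarrow> dim K \<le> dim M"
    using ex_has_least_nat[of ?P L dim] assms by blast
  show thesis
  proof (rule that)
    fix M assume M: "left_ideal_in UNIV M" "M \<subseteq> K" "M \<noteq> {0}"
    then have "dim K \<le> dim M" using K by blast
    then show "M = K" using left_ideal_eq_if_dim_le K(1) M by blast
  qed (use K(1) in auto)
qed

text \<open>Brauer's lemma.\<close>

lemma nonzero_left_ideal_has_idempotent:
  fixes L :: "'a set"
  assumes semiprime: "\<And>x :: 'a. (\<And>a. x * a * x = 0) \<Longrightarrow> x = 0"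
    and L: "left_ideal_in UNIV L" "L \<noteq> {0}"
  obtains g where "g \<in> L" "g * g = g" "g \<noteq> 0"
proof -
  obtain K where K: "left_ideal_in UNIV K" "K \<noteq> {0}" "K \<subseteq> L"
    and min: "\<And>M. left_ideal_in UNIV M \<Longrightarrow> M \<subseteq> K \<Longrightarrow> M \<noteq> {0} \<Longrightarrow> M = K"
    using minimal_left_ideal[OF L] by blast
  have K0: "0 \<in> K" and Kadd: "\<And>x y. x \<in> K \<Longrightarrow> y \<in> K \<Longrightarrow> x + y \<in> K"
    and Kneg: "\<And>x. x \<in> K \<Longrightarrow> - x \<in> K" and Kmul: "\<And>r x. x \<in> K \<Longrightarrow> r * x \<in> K"
    using K(1) by (auto simp: left_ideal_in_def)
  obtain x where x: "x \<in> K" "x \<noteq> 0" using K(2) K0 by blast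
  obtain b where b: "x * b * x \<noteq> 0" using semiprime[of x] x by blast
  define a where "a = b * x"
  have a: "a \<in> K" "x * a \<noteq> 0" using x b Kmul by (auto simp: a_def mult.assoc)
  \<comment> \<open>The left ideal \<open>K a\<close> is contained in \<open>K\<close> and contains
    \<open>x * a\<close>, which is nonzero. By minimality it equals \<open>K\<close>, so
    \<open>a\<close> itself has the form \<open>g * a\<close> with \<open>g\<close> in
    \<open>K\<close>.\<close>
  have "left_ideal_in UNIV ((\<lambda>y. y * a) ` K)"
    unfolding left_ideal_in_def
  proof (intro conjI ballI)
    show "0 \<in> (\<lambda>y. y * a) ` K" using K0 by (metis image_eqI mult_zero_left)
  next
    fix u v assume "u \<in> (\<lambda>y. y * a) ` K" "v \<in> (\<lambda>y. y * a) ` K"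
    then obtain p q where "u = p * a" "p \<in> K" "v = q * a" "q \<in> K" by (elim imageE)
    then show "u + v \<in> (\<lambda>y. y * a) ` K"
      using Kadd by (intro image_eqI[of _ _ "p + q"]) (simp_all add: distrib_right)
  next
    fix u assume "u \<in> (\<lambda>y. y * a) ` K"
    then obtain p where p: "u = p * a" "p \<in> K" by (elim imageE)
    then show "- u \<in> (\<lambda>y. y * a) ` K"
      using Kneg by (intro image_eqI[of _ _ "- p"]) simp_all
    show "r * u \<in> (\<lambda>y. y * a) ` K" for r
      using p Kmul by (intro image_eqI[of _ _ "r * p"]) (simp_all add: mult.assoc)
  qed auto
  moreover have "(\<lambda>y. y * a) ` K \<subseteq> K" using Kmul a by blast
  moreover have "(\<lambda>y. y * a) ` K \<noteq> {0}" using x a by blast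
  ultimately have "(\<lambda>y. y * a) ` K = K" by (rule min)
  then obtain g where g: "g \<in> K" "g * a = a" using a(1) by (metis imageE)
  \<comment> \<open>The annihilator of \<open>a\<close> in \<open>K\<close> misses \<open>x\<close>,
    so minimality makes it zero. It contains \<open>g * g - g\<close>, which makes \<open>g\<close>
    idempotent.\<close>
  have "left_ideal_in UNIV {y \<in> K. y * a = 0}"
    unfolding left_ideal_in_def using K0 Kadd Kneg Kmul
    by (auto simp: distrib_right mult.assoc)
  moreover have "{y \<in> K. y * a = 0} \<noteq> K" using x a by blast
  ultimately have ann: "{y \<in> K. y * a = 0} = {0}" using min by blast
  have "g * g - g \<in> K" using left_ideal_in_diff[OF K(1)] Kmul g by blast
  moreover have "(g * g - g) * a = 0" using g by (simp add: left_diff_distrib mult.assoc)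
  ultimately have "g * g - g = 0" using ann by blast
  moreover have "g \<noteq> 0" using g a by auto
  ultimately show thesis using that g(1) K(3) by auto
qed

text \<open>Among the idempotents of \<open>L\<close> (there is at least \<open>0\<close>), take
  \<open>f\<close> with left annihilator in \<open>L\<close> of least dimension. A nonzero
  annihilator would contain an idempotent \<open>g\<close>, and joining \<open>g\<close> to
  \<open>f\<close> would shrink it. So it is zero, and \<open>x - x * f\<close> vanishes for every
  \<open>x\<close> in \<open>L\<close>.\<close>

lemma semisimple_if_semiprime:
  assumes semiprime: "\<And>x :: 'a. (\<And>a. x * a * x = 0) \<Longrightarrow> x = 0"
  shows "semisimple_ring_on (UNIV :: 'a set)"
proof -
  have "\<exists>f\<in>L. \<forall>x\<in>L. x * f = x" if L: "left_ideal_in UNIV L" for L :: "'a set"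
  proof -
    have L0: "0 \<in> L" and Ladd: "\<And>x y. x \<in> L \<Longrightarrow> y \<in> L \<Longrightarrow> x + y \<in> L"
      and Lneg: "\<And>x. x \<in> L \<Longrightarrow> - x \<in> L" and Lmul: "\<And>r x. x \<in> L \<Longrightarrow> r * x \<in> L"
      using L by (auto simp: left_ideal_in_def)
    define ann where "ann f = {x \<in> L. x * f = 0}" for f
    have ann: "left_ideal_in UNIV (ann f)" for f
      unfolding left_ideal_in_def ann_def using L0 Ladd Lneg Lmul
      by (auto simp: distrib_right mult.assoc)
    let ?P = "\<lambda>f. f \<in> L \<and> f * f = f"
    obtain f where f: "?P f" and f_min: "\<And>h. ?P h \<Longrightarrow> dim (ann f) \<le> dim (ann h)"
      using ex_has_least_nat[of ?P 0 "\<lambda>f. dim (ann f)"] L0 by auto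
    have "ann f = {0}"
    proof (rule ccontr)
      assume "ann f \<noteq> {0}"
      then obtain g where g: "g \<in> ann f" "g * g = g" "g \<noteq> 0"
        using nonzero_left_ideal_has_idempotent[OF semiprime ann] by blast
      have gf: "g * f = 0" "g \<in> L" using g by (auto simp: ann_def)
      \<comment> \<open>Since \<open>g * f = 0\<close>, this \<open>h\<close> fixes both
        \<open>f\<close> and \<open>g\<close> under left multiplication. Hence
        \<open>x * h = 0\<close> forces \<open>x * f = 0\<close> and \<open>x * g = 0\<close>; the
        second fails for \<open>x = g\<close>, which does lie in \<open>ann f\<close>.\<close>
      define h where "h = f + g - f * g"
      have hf: "h * f = f" using f gf by (simp add: h_def algebra_simps)
      have hg: "h * g = g" using f g by (simp add: h_def algebra_simps)
      have hL: "h \<in> L" unfolding h_def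
        using left_ideal_in_diff[OF L] Ladd Lmul f gf by blast
      have "h * h = h * f + h * g - (h * f) * g"
        by (subst (2) h_def) (simp add: algebra_simps)
      then have hh: "h * h = h" by (simp add: hf hg) (simp add: h_def)
      have sub: "x \<in> ann f \<and> x * g = 0" if "x \<in> ann h" for x
      proof -
        have "x \<in> L" "x * h = 0" using that by (auto simp: ann_def)
        then have "x * f = 0" "x * g = 0" using hf hg by (metis mult.assoc mult_zero_left)+
        then show ?thesis using \<open>x \<in> L\<close> by (simp add: ann_def)
      qed
      then have "ann h = ann f"
        using left_ideal_eq_if_dim_le[OF ann ann, of h f] f_min[of h] hL hh by blast
      then show False using sub g by auto
    qed
    have "x * f = x" if "x \<in> L" for x
    proof -
      have "x - x * f \<in> ann f"
        using that f left_ideal_in_diff[OF L] Lmul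
        by (auto simp: ann_def left_diff_distrib mult.assoc)
      then show ?thesis using \<open>ann f = {0}\<close> by simp
    qed
    then show ?thesis using f by blast
  qed
  then show ?thesis using semisimple_cornerI[of "1 :: 'a"] by (simp add: corner_one)
qed

end

section \<open>Coefficients in a cellular basis\<close>

locale cellular =
  fixes scale :: "'k::field \<Rightarrow> 'a::ring_1 \<Rightarrow> 'a"
    and po :: "'l rel" and \<Lambda> :: "'l set" and T :: "'l \<Rightarrow> 't set"
    and c :: "'l \<Rightarrow> 't \<Rightarrow> 't \<Rightarrow> 'a" and star :: "'a \<Rightarrow> 'a"
  assumes cell: "cellular_algebra scale po \<Lambda> T c star"
begin

definition cell_basis :: "'a set" where
  "cell_basis = {c la s t | la s t. la \<in> \<Lambda> \<and> s \<in> T la \<and> t \<in> T la}"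

definition cell_index :: "('l \<times> 't \<times> 't) set" where
  "cell_index = {(la, s, t). la \<in> \<Lambda> \<and> s \<in> T la \<and> t \<in> T la}"

lemma cell_basis_eq: "cell_basis = (\<lambda>(la, s, t). c la s t) ` cell_index"
  by (auto simp: cell_basis_def cell_index_def image_iff) force+

lemma finite_cell_index: "finite cell_index"
proof -
  have "cell_index = (SIGMA la:\<Lambda>. T la \<times> T la)" by (auto simp: cell_index_def)
  then show ?thesis using cell by (auto simp: cellular_algebra_def)
qed

lemma inj_cell_index: "inj_on (\<lambda>(la, s, t). c la s t) cell_index"
  using cell by (auto simp: cellular_algebra_def cell_index_def)

sublocale fin_dim_algebra scale cell_basis
proof -
  have alg: "f_algebra scale" using cell by (simp add: cellular_algebra_def)
  then interpret vs: vector_space scale by (simp add: f_algebra_def)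
  show "fin_dim_algebra scale cell_basis"
  proof
    show "finite cell_basis" using finite_cell_index by (simp add: cell_basis_eq)
    show "\<not> vs.dependent cell_basis" "vs.span cell_basis = UNIV"
      using cell by (simp_all add: cellular_algebra_def cell_basis_def)
  qed (rule alg)
qed

lemma finite_T: "la \<in> \<Lambda> \<Longrightarrow> finite (T la)"
  using cell by (simp add: cellular_algebra_def)

lemma po_trans: "(x, y) \<in> po \<Longrightarrow> (y, z) \<in> po \<Longrightarrow> (x, z) \<in> po"
  and po_antisym: "(x, y) \<in> po \<Longrightarrow> (y, x) \<in> po \<Longrightarrow> x = y"
  and po_refl: "x \<in> \<Lambda> \<Longrightarrow> (x, x) \<in> po"
  using cell unfolding cellular_algebra_def partial_order_on_def preorder_on_def
  by (blast dest: transD antisymD refl_onD)+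

lemma star_add: "star (x + y) = star x + star y"
  and star_scale: "star (scale k x) = scale k (star x)"
  and star_mult: "star (x * y) = star y * star x"
  and star_star: "star (star x) = x"
  and star_c: "la \<in> \<Lambda> \<Longrightarrow> s \<in> T la \<Longrightarrow> t \<in> T la \<Longrightarrow> star (c la s t) = c la t s"
  using cell by (simp_all add: cellular_algebra_def)

definition coef :: "'l \<Rightarrow> 't \<Rightarrow> 't \<Rightarrow> 'a \<Rightarrow> 'k" where
  "coef la s t x = representation cell_basis x (c la s t)"

lemma coef_add: "coef la s t (x + y) = coef la s t x + coef la s t y"
  by (simp add: coef_def representation_add independent_Basis span_Basis)

lemma coef_scale: "coef la s t (scale k x) = k * coef la s t x"
  by (simp add: coef_def representation_scale independent_Basis span_Basis)

lemma coef_zero: "coef la s t 0 = 0"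
  by (simp add: coef_def representation_zero)

lemma coef_sum: "coef la s t (\<Sum>x\<in>A. f x) = (\<Sum>x\<in>A. coef la s t (f x))"
  by (induction A rule: infinite_finite_induct) (auto simp: coef_add coef_zero)

lemma coef_c:
  assumes "la \<in> \<Lambda>" "s \<in> T la" "t \<in> T la" "mu \<in> \<Lambda>" "u \<in> T mu" "v \<in> T mu"
  shows "coef la s t (c mu u v) = (if la = mu \<and> s = u \<and> t = v then 1 else 0)"
proof -
  have "c mu u v \<in> cell_basis" using assms by (auto simp: cell_basis_def)
  then have "coef la s t (c mu u v) = (if c mu u v = c la s t then 1 else 0)"
    by (auto simp: coef_def representation_basis independent_Basis)
  moreover have "c mu u v = c la s t \<longleftrightarrow> la = mu \<and> s = u \<and> t = v"
    using inj_onD[OF inj_cell_index, of "(mu, u, v)" "(la, s, t)"] assms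
    by (auto simp: cell_index_def)
  ultimately show ?thesis by simp
qed

lemma coef_expand: "x = (\<Sum>(la, s, t)\<in>cell_index. scale (coef la s t x) (c la s t))"
proof -
  have "x = (\<Sum>b\<in>cell_basis. scale (representation cell_basis x b) b)"
    using sum_representation_eq[OF independent_Basis _ finite_Basis order_refl, of x]
    by (simp add: span_Basis)
  also have "\<dots> = (\<Sum>(la, s, t)\<in>cell_index. scale (coef la s t x) (c la s t))"
    unfolding cell_basis_eq
    by (subst sum.reindex[OF inj_cell_index])
       (auto simp: coef_def cell_basis_eq intro!: sum.cong)
  finally show ?thesis .
qed

lemma coef_eq_zero_imp_zero:
  assumes "\<And>la s t. la \<in> \<Lambda> \<Longrightarrow> s \<in> T la \<Longrightarrow> t \<in> T la \<Longrightarrow> coef la s t x = 0"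
  shows "x = 0"
  by (subst coef_expand, rule sum.neutral) (auto simp: cell_index_def assms)

lemma coef_mult_expand:
  "coef la w v (a * x) = (\<Sum>(mu, s, t)\<in>cell_index. coef mu s t x * coef la w v (a * c mu s t))"
proof -
  have "a * x = a * (\<Sum>(mu, s, t)\<in>cell_index. scale (coef mu s t x) (c mu s t))"
    using coef_expand by simp
  also have "\<dots> = (\<Sum>(mu, s, t)\<in>cell_index. scale (coef mu s t x) (a * c mu s t))"
    by (auto simp: sum_distrib_left scale_mult_right intro!: sum.cong)
  finally show ?thesis by (auto simp: coef_sum coef_scale intro!: sum.cong)
qed

text \<open>Both sides are additive and homogeneous in \<open>x\<close>, and on the basis
  \<open>star\<close> just transposes the two indices.\<close>

lemma coef_star:
  assumes "la \<in> \<Lambda>" "s \<in> T la" "t \<in> T la"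
  shows "coef la s t (star x) = coef la t s x"
proof -
  have "x \<in> span cell_basis" by (simp add: span_Basis)
  then show ?thesis
  proof (induction rule: span_induct_alt)
    case base
    have "star 0 = 0" using star_add[of 0 0] by simp
    then show ?case by (simp add: coef_zero)
  next
    case (step k b y)
    obtain mu u v where b: "b = c mu u v" "mu \<in> \<Lambda>" "u \<in> T mu" "v \<in> T mu"
      using step(1) by (auto simp: cell_basis_def)
    have "coef la s t (star b) = coef la t s b"
      using assms b by (auto simp: star_c coef_c)
    then show ?case using step by (simp add: star_add star_scale coef_add coef_scale)
  qed
qed

lemma coef_higher_span:
  assumes "h \<in> higher_span scale po \<Lambda> T c mu" and la: "la \<in> \<Lambda>" "s \<in> T la" "t \<in> T la"
    and "coef la s t h \<noteq> 0"
  shows "(mu, la) \<in> po \<and> la \<noteq> mu"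
proof (rule ccontr)
  assume not: "\<not> ((mu, la) \<in> po \<and> la \<noteq> mu)"
  have "coef la s t h = 0"
    using assms(1) unfolding higher_span_def
  proof (induction rule: span_induct_alt)
    case base
    then show ?case by (rule coef_zero)
  next
    case (step k b y)
    then obtain nu u v where b: "b = c nu u v" "nu \<in> \<Lambda>" "u \<in> T nu" "v \<in> T nu"
      "(mu, nu) \<in> po" "nu \<noteq> mu" by blast
    then have "coef la s t b = 0" using la not by (auto simp: coef_c)
    with step show ?case by (simp add: coef_add coef_scale)
  qed
  with assms show False by blast
qed

text \<open>The cellular multiplication rule read in coordinates: the remainder is supported
  strictly above \<open>mu\<close>, so at every other cell only the explicit sum contributes. One
  \<open>r\<close> serves all columns \<open>t\<close>.\<close>

lemma coef_mult_basis:
  assumes mu: "mu \<in> \<Lambda>" "s \<in> T mu"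
  obtains r where "\<And>la w t v. la \<in> \<Lambda> \<Longrightarrow> w \<in> T la \<Longrightarrow> v \<in> T la \<Longrightarrow> t \<in> T mu \<Longrightarrow>
      \<not> ((mu, la) \<in> po \<and> la \<noteq> mu) \<Longrightarrow>
      coef la w v (a * c mu s t) = (if la = mu \<and> v = t then r w else 0)"
proof -
  obtain r where r: "\<forall>t\<in>T mu. a * c mu s t - (\<Sum>u\<in>T mu. scale (r u) (c mu u t))
      \<in> higher_span scale po \<Lambda> T c mu"
    using cell mu unfolding cellular_algebra_def by blast
  show thesis
  proof (rule that)
    fix la w t v
    assume la: "la \<in> \<Lambda>" "w \<in> T la" "v \<in> T la" and t: "t \<in> T mu"
      and not: "\<not> ((mu, la) \<in> po \<and> la \<noteq> mu)"
    let ?y = "\<Sum>u\<in>T mu. scale (r u) (c mu u t)"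
    have "coef la w v (a * c mu s t - ?y) = 0"
      using coef_higher_span[of _ mu la w v] r t la not by blast
    moreover have "coef la w v (a * c mu s t) = coef la w v (a * c mu s t - ?y) + coef la w v ?y"
      by (simp add: coef_add[symmetric])
    moreover have "coef la w v ?y = (\<Sum>u\<in>T mu. if u = w then (if la = mu \<and> v = t then r w else 0) else 0)"
      using la mu t by (auto simp: coef_sum coef_scale coef_c intro!: sum.cong)
    ultimately show "coef la w v (a * c mu s t) = (if la = mu \<and> v = t then r w else 0)"
      using la mu finite_T[of mu] by auto
  qed
qed

lemma coef_mult_basis_zero:
  assumes "mu \<in> \<Lambda>" "s \<in> T mu" "t \<in> T mu" "la \<in> \<Lambda>" "w \<in> T la" "v \<in> T la" "(mu, la) \<notin> po"
  shows "coef la w v (a * c mu s t) = 0"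
proof -
  have "la \<noteq> mu" using assms po_refl by blast
  with assms show ?thesis by (metis coef_mult_basis)
qed

text \<open>This is the span of the basis elements at cells not strictly below \<open>la\<close>. A
  minimal cell in the support of an element need not lie below the rest of the support, so the span
  of the cells above \<open>la\<close> would be too small.\<close>

definition no_lower :: "'l \<Rightarrow> 'a set" where
  "no_lower la = {x. \<forall>mu\<in>\<Lambda>. (mu, la) \<in> po \<longrightarrow> mu \<noteq> la \<longrightarrow> (\<forall>s\<in>T mu. \<forall>t\<in>T mu. coef mu s t x = 0)}"

lemma no_lower_star: "x \<in> no_lower la \<Longrightarrow> star x \<in> no_lower la"
  by (auto simp: no_lower_def coef_star)

text \<open>Left multiplication only moves cells upwards: a coordinate of the product at
  \<open>mu\<close> below \<open>la\<close> can come only from cells weakly below \<open>mu\<close>,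
  where \<open>x\<close> has no coordinates.\<close>

lemma no_lower_mult_left:
  assumes x: "x \<in> no_lower la"
  shows "a * x \<in> no_lower la"
  unfolding no_lower_def
proof (intro CollectI ballI impI)
  fix mu s t assume mu: "mu \<in> \<Lambda>" "(mu, la) \<in> po" "mu \<noteq> la" "s \<in> T mu" "t \<in> T mu"
  have "coef nu u v x * coef mu s t (a * c nu u v) = 0"
    if nu: "nu \<in> \<Lambda>" "u \<in> T nu" "v \<in> T nu" for nu u v
  proof (cases "(nu, mu) \<in> po")
    case True
    then have "(nu, la) \<in> po" "nu \<noteq> la" using mu po_trans po_antisym by blast+
    then show ?thesis using x nu by (simp add: no_lower_def)
  qed (use coef_mult_basis_zero nu mu in simp)
  then show "coef mu s t (a * x) = 0"
    unfolding coef_mult_expand[of mu s t a x] by (intro sum.neutral) (auto simp: cell_index_def)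
qed

lemma no_lower_add: "x \<in> no_lower la \<Longrightarrow> y \<in> no_lower la \<Longrightarrow> x + y \<in> no_lower la"
  and no_lower_scale: "x \<in> no_lower la \<Longrightarrow> scale k x \<in> no_lower la"
  and no_lower_zero: "0 \<in> no_lower la"
  by (auto simp: no_lower_def coef_add coef_scale coef_zero)

lemma no_lower_sum: "(\<And>i. i \<in> A \<Longrightarrow> f i \<in> no_lower la) \<Longrightarrow> (\<Sum>i\<in>A. f i) \<in> no_lower la"
  by (induction A rule: infinite_finite_induct) (auto simp: no_lower_add no_lower_zero)

lemma no_lower_mult_right:
  assumes "x \<in> no_lower la"
  shows "x * a \<in> no_lower la"
  using no_lower_star[OF no_lower_mult_left[OF no_lower_star[OF assms], of "star a"]]
  by (simp add: star_mult star_star)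

lemma no_lower_c: "la \<in> \<Lambda> \<Longrightarrow> s \<in> T la \<Longrightarrow> t \<in> T la \<Longrightarrow> c la s t \<in> no_lower la"
  by (auto simp: no_lower_def coef_c)

text \<open>On \<open>no_lower la\<close>, the matrix of coefficients at \<open>la\<close> is a bimodule map into the square
  matrices: left multiplication by \<open>a\<close> becomes left multiplication by a matrix depending only
  on \<open>a\<close>, and likewise on the right.\<close>

lemma coef_mult_left:
  assumes la: "la \<in> \<Lambda>"
  obtains r where "\<And>x w v. x \<in> no_lower la \<Longrightarrow> w \<in> T la \<Longrightarrow> v \<in> T la \<Longrightarrow>
      coef la w v (a * x) = (\<Sum>s\<in>T la. r w s * coef la s v x)"
proof -
  have "\<forall>s\<in>T la. \<exists>r. \<forall>w\<in>T la. \<forall>t\<in>T la. \<forall>v\<in>T la.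
      coef la w v (a * c la s t) = (if v = t then r w else 0)"
    using coef_mult_basis[OF la, of _ a] la by (smt (verit))
  then obtain R where R: "\<And>s w t v. s \<in> T la \<Longrightarrow> w \<in> T la \<Longrightarrow> t \<in> T la \<Longrightarrow> v \<in> T la \<Longrightarrow>
      coef la w v (a * c la s t) = (if v = t then R s w else 0)"
    by metis
  show thesis
  proof (rule that)
    fix x w v assume x: "x \<in> no_lower la" and w: "w \<in> T la" and v: "v \<in> T la"
    let ?f = "\<lambda>(mu, s, t). coef mu s t x * coef la w v (a * c mu s t)"
    have "coef la w v (a * x) = sum ?f cell_index" by (rule coef_mult_expand)
    \<comment> \<open>Cells below \<open>la\<close> carry no coefficient of \<open>x\<close>, cells
      not below \<open>la\<close> do not reach \<open>la\<close>, and at \<open>la\<close> itself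
      only column \<open>v\<close> contributes to column \<open>v\<close>.\<close>
    also have "\<dots> = sum ?f ((\<lambda>s. (la, s, v)) ` T la)"
    proof (rule sum.mono_neutral_right[OF finite_cell_index])
      show "(\<lambda>s. (la, s, v)) ` T la \<subseteq> cell_index" using la v by (auto simp: cell_index_def)
      show "\<forall>p\<in>cell_index - (\<lambda>s. (la, s, v)) ` T la. ?f p = 0"
      proof clarify
        fix mu s t
        assume "(mu, s, t) \<in> cell_index" and notin: "(mu, s, t) \<notin> (\<lambda>s. (la, s, v)) ` T la"
        then have mu: "mu \<in> \<Lambda>" "s \<in> T mu" "t \<in> T mu" by (auto simp: cell_index_def)
        show "coef mu s t x * coef la w v (a * c mu s t) = 0"
        proof (cases "mu = la")
          case True
          then show ?thesis using notin R mu w v by auto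
        next
          case False
          then show ?thesis
            using x mu la w v coef_mult_basis_zero by (cases "(mu, la) \<in> po") (auto simp: no_lower_def)
        qed
      qed
    qed
    also have "\<dots> = (\<Sum>s\<in>T la. coef la s v x * coef la w v (a * c la s v))"
      by (subst sum.reindex) (auto simp: inj_on_def)
    also have "\<dots> = (\<Sum>s\<in>T la. R s w * coef la s v x)"
      using R w v by (auto intro!: sum.cong simp: mult.commute)
    finally show "coef la w v (a * x) = (\<Sum>s\<in>T la. R s w * coef la s v x)" .
  qed
qed

text \<open>Transpose with \<open>star\<close> and apply the left version to
  \<open>star a * star x\<close>.\<close>

lemma coef_mult_right:
  assumes la: "la \<in> \<Lambda>"
  obtains r where "\<And>x w v. x \<in> no_lower la \<Longrightarrow> w \<in> T la \<Longrightarrow> v \<in> T la \<Longrightarrow>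
      coef la w v (x * a) = (\<Sum>s\<in>T la. r v s * coef la w s x)"
proof -
  obtain r where r: "\<And>x w v. x \<in> no_lower la \<Longrightarrow> w \<in> T la \<Longrightarrow> v \<in> T la \<Longrightarrow>
      coef la w v (star a * x) = (\<Sum>s\<in>T la. r w s * coef la s v x)"
    using coef_mult_left[OF la, of "star a"] by blast
  show thesis
  proof (rule that)
    fix x w v assume x: "x \<in> no_lower la" and w: "w \<in> T la" and v: "v \<in> T la"
    have "coef la w v (x * a) = coef la v w (star a * star x)"
      using coef_star[OF la v w, of "x * a"] by (simp add: star_mult)
    also have "\<dots> = (\<Sum>s\<in>T la. r v s * coef la s w (star x))"
      using r no_lower_star[OF x] w v by blast
    also have "\<dots> = (\<Sum>s\<in>T la. r v s * coef la w s x)"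
      using coef_star la w by (auto intro!: sum.cong)
    finally show "coef la w v (x * a) = (\<Sum>s\<in>T la. r v s * coef la w s x)" .
  qed
qed

text \<open>The set of cells in the support is finite and nonempty, so the strict order is well
  founded on it and has a minimal element there.\<close>

lemma minimal_support:
  assumes "x \<noteq> 0"
  obtains la s t where "la \<in> \<Lambda>" "s \<in> T la" "t \<in> T la" "coef la s t x \<noteq> 0" "x \<in> no_lower la"
proof -
  define S where "S = {la \<in> \<Lambda>. \<exists>s\<in>T la. \<exists>t\<in>T la. coef la s t x \<noteq> 0}"
  have "finite S" using cell by (simp add: S_def cellular_algebra_def)
  have "S \<noteq> {}" using coef_eq_zero_imp_zero[of x] assms by (auto simp: S_def)
  define lt where "lt = {(y, z). (y, z) \<in> po \<and> y \<noteq> z}"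
  have "trans lt" unfolding lt_def trans_def using po_trans po_antisym by blast
  moreover have "irrefl lt" by (auto simp: lt_def irrefl_def)
  ultimately have "acyclic lt" by (simp add: acyclic_irrefl)
  then have "wf (Restr lt S)"
    using \<open>finite S\<close> by (intro finite_acyclic_wf) (auto intro: acyclic_subset)
  then obtain la where la: "la \<in> S" and min: "\<And>y. (y, la) \<in> Restr lt S \<Longrightarrow> y \<notin> S"
    using \<open>S \<noteq> {}\<close> by (metis wfE_min ex_in_conv)
  have "x \<in> no_lower la"
    using min la by (force simp: no_lower_def S_def lt_def)
  with la show thesis using that by (auto simp: S_def)
qed

text \<open>If the element \<open>x\<close> of the Peirce component \<open>(j, k)\<close> is not killed at \<open>la\<close> by left
  multiplication, then rows of a product with \<open>x\<close> can be moved to the \<open>k\<close>-block, giving a nonzero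
  element of the corner at \<open>k\<close> that generates a square-zero ideal. Otherwise a nonzero column
  of \<open>x\<close>, placed in a column of the \<open>j\<close>-block, lies in the left ideal \<open>L\<close> of the corner at \<open>j\<close> whose
  products vanish at \<open>la\<close>, which has no right unit.\<close>

lemma peirce_component_zero:
  fixes e :: "'i \<Rightarrow> 'a"
  assumes idem: "\<forall>i\<in>I. e i * e i = e i"
    and orth: "\<forall>i\<in>I. \<forall>j\<in>I. i \<noteq> j \<longrightarrow> e i * e j = 0"
    and A3: "\<forall>la\<in>\<Lambda>. \<forall>t\<in>T la. \<exists>i\<in>I. \<forall>s\<in>T la. e i * c la t s = c la t s"
    and A4: "\<forall>i\<in>I. star (e i) = e i"
    and ss: "\<forall>i\<in>I. semisimple_ring_on (corner (e i))"
    and j: "j \<in> I" and k: "k \<in> I" and ejx: "e j * x = x" and xek: "x * e k = x"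
    and xx: "\<And>a. x * a * x = 0"
  shows "x = 0"
proof (rule ccontr)
  assume "x \<noteq> 0"
  then obtain la s t where la: "la \<in> \<Lambda>" and s: "s \<in> T la" and t: "t \<in> T la"
    and st: "coef la s t x \<noteq> 0" and x: "x \<in> no_lower la"
    using minimal_support by metis
  \<comment> \<open>A row of \<open>y = e i * y\<close> with a nonzero entry at \<open>la\<close>
    must belong to block \<open>i\<close>. Otherwise that row of the matrix of left multiplication
    by \<open>e i\<close> is zero.\<close>
  have left_block: "e i * c la s' v = c la s' v"
    if i: "i \<in> I" and y: "y \<in> no_lower la" "e i * y = y"
      and s': "s' \<in> T la" and t': "t' \<in> T la" and nz: "coef la s' t' y \<noteq> 0" and v: "v \<in> T la"
    for i y s' t' v
  proof -
    obtain i' where i': "i' \<in> I" "\<forall>v\<in>T la. e i' * c la s' v = c la s' v"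
      using A3 la s' by blast
    have "i' = i"
    proof (rule ccontr)
      assume "i' \<noteq> i"
      obtain r where r: "\<And>x w v. x \<in> no_lower la \<Longrightarrow> w \<in> T la \<Longrightarrow> v \<in> T la \<Longrightarrow>
          coef la w v (e i * x) = (\<Sum>s\<in>T la. r w s * coef la s v x)"
        using coef_mult_left[OF la] by blast
      \<comment> \<open>Test the matrix entry on \<open>c la u t'\<close>. If row \<open>u\<close>
        is in block \<open>i\<close>, the element is fixed and \<open>u\<close> differs from
        \<open>s'\<close>; if not, orthogonality kills it.\<close>
      have "r s' u = 0" if u: "u \<in> T la" for u
      proof -
        have "r s' u = (\<Sum>q\<in>T la. if q = u then r s' q else 0)"
          using finite_T[OF la] u by simp
        also have "\<dots> = (\<Sum>q\<in>T la. r s' q * coef la q t' (c la u t'))"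
          using u la t' by (intro sum.cong) (auto simp: coef_c)
        also have "\<dots> = coef la s' t' (e i * c la u t')"
          using r no_lower_c la u s' t' by simp
        finally have rc: "r s' u = coef la s' t' (e i * c la u t')" .
        obtain i'' where i'': "i'' \<in> I" "\<forall>v\<in>T la. e i'' * c la u v = c la u v"
          using A3 la u by blast
        show ?thesis
        proof (cases "i'' = i")
          case True
          then have "u \<noteq> s'"
          proof (intro notI)
            assume "u = s'"
            then have "c la s' t' = e i' * (e i * c la s' t')"
              using True i' i'' t' by simp
            also have "\<dots> = 0"
              using orth i' i \<open>i' \<noteq> i\<close> by (simp add: mult.assoc[symmetric])
            finally show False
              using coef_c[of la s' t' la s' t'] la s' t'
              by (simp add: coef_zero)
          qed
          then show ?thesis using rc True i'' la u s' t' by (simp add: coef_c)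
        next
          case False
          have "e i * c la u t' = e i * (e i'' * c la u t')" using i'' t' by simp
          also have "\<dots> = 0" using orth i'' i False by (simp add: mult.assoc[symmetric])
          finally show ?thesis using rc by (simp add: coef_zero)
        qed
      qed
      then have "coef la s' t' (e i * y) = 0" using r[OF y(1) s' t'] by simp
      then show False using nz y by simp
    qed
    then show ?thesis using i' v by blast
  qed
  have right_of_left: "c la v u * e i = c la v u"
    if "i \<in> I" "u \<in> T la" "v \<in> T la" "e i * c la u v = c la u v" for i u v
    using star_mult[of "e i" "c la u v"] that A4 la by (simp add: star_c)
  have block_s: "e j * c la s v = c la s v" if "v \<in> T la" for v
    using left_block[OF j x ejx s t st that] .
  have block_t: "e k * c la t v = c la t v" if "v \<in> T la" for v
  proof -
    have "e k * star x = star x" using star_mult[of x "e k"] xek A4 k by simp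
    then show ?thesis
      using left_block[OF k no_lower_star[OF x] _ t s] that st coef_star la s t by simp
  qed
  show False
  proof (cases "\<exists>a\<in>no_lower la. \<exists>w\<in>T la. \<exists>v\<in>T la. coef la w v (a * x) \<noteq> 0")
    case True
    then obtain a w v where a: "a \<in> no_lower la" and w: "w \<in> T la" and v: "v \<in> T la"
      and nz: "coef la w v (a * x) \<noteq> 0" by blast
    obtain r where r: "\<And>y w v. y \<in> no_lower la \<Longrightarrow> w \<in> T la \<Longrightarrow> v \<in> T la \<Longrightarrow>
        coef la w v (y * x) = (\<Sum>s\<in>T la. r v s * coef la w s y)"
      using coef_mult_right[OF la] by blast
    obtain u where u: "u \<in> T la" "r v u \<noteq> 0"
      using nz r[OF a w v] by (metis (no_types, lifting) mult_zero_left sum.neutral)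
    \<comment> \<open>The row \<open>w\<close> of \<open>a\<close> is replaced by a unit row at
      \<open>u\<close>, placed in row \<open>t\<close>. Row \<open>t\<close> is in block
      \<open>k\<close>, so \<open>z\<close> lies in the corner at \<open>k\<close>, while the entry
      \<open>r v u\<close> keeps it nonzero.\<close>
    define z where "z = c la t u * x"
    have "coef la t v z = (\<Sum>q\<in>T la. r v q * coef la t q (c la t u))"
      using r no_lower_c la t u v by (simp add: z_def)
    also have "\<dots> = (\<Sum>q\<in>T la. if q = u then r v q else 0)"
      using u la t by (intro sum.cong) (auto simp: coef_c)
    also have "\<dots> = r v u" using u finite_T[OF la] by simp
    finally have "z \<noteq> 0" using u by (auto simp: coef_zero)
    have "z \<in> corner (e k)"
      using idem k block_t[OF u(1)] xek
      by (simp add: z_def corner_iff mult.assoc) (simp add: mult.assoc[symmetric])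
    moreover have "z * b * z = 0" for b
    proof -
      have "z * b * z = c la t u * (x * (b * c la t u) * x)" by (simp add: z_def mult.assoc)
      then show ?thesis using xx by simp
    qed
    ultimately show False using semisimple_corner_semiprime[of "e k" z] idem ss k \<open>z \<noteq> 0\<close> by blast
  next
    case False
    \<comment> \<open>Column \<open>t\<close> of \<open>x\<close> is moved to column
      \<open>s\<close>. As \<open>s\<close> indexes a row of block \<open>j\<close>, column
      \<open>s\<close> is fixed by \<open>e j\<close> on the right, which puts \<open>z\<close> in
      the corner at \<open>j\<close>.\<close>
    define z where "z = (\<Sum>q\<in>T la. scale (coef la q t x) (c la q s))"
    have z: "z \<in> no_lower la"
      unfolding z_def by (intro no_lower_sum no_lower_scale no_lower_c la s)
    have coef_z: "coef la w v z = (if v = s then coef la w t x else 0)"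
      if "w \<in> T la" "v \<in> T la" for w v
    proof -
      have "coef la w v z = (\<Sum>q\<in>T la. if q = w then (if v = s then coef la w t x else 0) else 0)"
        unfolding z_def coef_sum using that la s
        by (intro sum.cong) (auto simp: coef_scale coef_c)
      then show ?thesis using finite_T[OF la] that by simp
    qed
    define L where "L = {y \<in> corner (e j). y \<in> no_lower la \<and>
      (\<forall>a\<in>no_lower la. \<forall>w\<in>T la. \<forall>v\<in>T la. coef la w v (a * y) = 0)}"
    have ejj: "e j * e j = e j" using idem j by blast
    have L: "left_ideal_in (corner (e j)) L"
      unfolding left_ideal_in_def
    proof (intro conjI ballI)
      show "L \<subseteq> corner (e j)" by (auto simp: L_def)
      show "0 \<in> L" by (auto simp: L_def corner_iff[OF ejj] no_lower_zero coef_zero)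
    next
      fix y y' assume "y \<in> L" "y' \<in> L"
      then show "y + y' \<in> L"
        by (auto simp: L_def corner_iff[OF ejj] no_lower_add coef_add distrib_left distrib_right)
    next
      fix y assume y: "y \<in> L"
      have "- y = scale (- 1) y" by simp
      then have "- y \<in> no_lower la" "\<And>a w v. coef la w v (a * - y) = - coef la w v (a * y)"
        using y no_lower_scale[of y la "- 1"] coef_scale[of la _ _ "- 1"]
        by (auto simp: L_def scale_mult_right)
      then show "- y \<in> L" using y by (auto simp: L_def corner_iff[OF ejj])
    next
      fix b y assume b: "b \<in> corner (e j)" and y: "y \<in> L"
      have "b * y \<in> corner (e j)"
        using b y by (auto simp: L_def corner_iff[OF ejj] mult.assoc) (metis mult.assoc)
      moreover have "coef la w v (a * (b * y)) = 0"
        if "a \<in> no_lower la" "w \<in> T la" "v \<in> T la" for a w v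
        using y that no_lower_mult_right[OF that(1), of b]
        by (auto simp: L_def mult.assoc[symmetric])
      ultimately show "b * y \<in> L" using y no_lower_mult_left by (auto simp: L_def)
    qed
    have "z \<in> corner (e j)"
    proof -
      have "e j * scale (coef la q t x) (c la q s) = scale (coef la q t x) (c la q s)"
        if "q \<in> T la" for q
        using left_block[OF j x ejx that t _ s] by (cases "coef la q t x = 0") (auto simp: scale_mult_right)
      moreover have "scale (coef la q t x) (c la q s) * e j = scale (coef la q t x) (c la q s)"
        if "q \<in> T la" for q
        using right_of_left[OF j s that block_s[OF that]] by (simp add: scale_mult_left)
      ultimately show ?thesis
        by (simp add: corner_iff[OF ejj] z_def sum_distrib_left sum_distrib_right)
    qed
    moreover have "coef la w v (a * z) = 0"
      if a: "a \<in> no_lower la" and w: "w \<in> T la" and v: "v \<in> T la" for a w v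
    proof -
      obtain r where r: "\<And>x w v. x \<in> no_lower la \<Longrightarrow> w \<in> T la \<Longrightarrow> v \<in> T la \<Longrightarrow>
          coef la w v (a * x) = (\<Sum>s\<in>T la. r w s * coef la s v x)"
        using coef_mult_left[OF la] by blast
      show ?thesis
      proof (cases "v = s")
        case True
        \<comment> \<open>Column \<open>s\<close> of \<open>a * z\<close> equals column
          \<open>t\<close> of \<open>a * x\<close>, which vanishes in the present case.\<close>
        have "coef la w v (a * z) = (\<Sum>q\<in>T la. r w q * coef la q t x)"
          using r[OF z w v] coef_z v True by simp
        also have "\<dots> = coef la w t (a * x)" using r[OF x w t] by simp
        finally show ?thesis using False a w t by simp
      qed (use r[OF z w v] coef_z v in simp)
    qed
    ultimately have zL: "z \<in> L" using z by (simp add: L_def)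
    obtain f where "f \<in> L" "\<And>y. y \<in> L \<Longrightarrow> y * f = y"
      using semisimple_corner_right_unit[OF ejj _ L] ss j by blast
    \<comment> \<open>As \<open>z\<close> is in \<open>no_lower la\<close> and \<open>f\<close> in
      \<open>L\<close>, the product \<open>z * f = z\<close> vanishes at \<open>la\<close>. But the
      \<open>(s, s)\<close> entry of \<open>z\<close> is the nonzero \<open>(s, t)\<close> entry of
      \<open>x\<close>.\<close>
    then have "coef la s s z = 0" using zL z s by (force simp: L_def)
    then show False using coef_z s st by simp
  qed
qed

end

section \<open>Semisimplicity of the algebra and of its corners\<close>

theorem theorem4p1:
  fixes scale :: "'k::field \<Rightarrow> 'a::ring_1 \<Rightarrow> 'a"
    and po :: "'l rel" and \<Lambda> :: "'l set" and T :: "'l \<Rightarrow> 't set"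
    and c :: "'l \<Rightarrow> 't \<Rightarrow> 't \<Rightarrow> 'a" and star :: "'a \<Rightarrow> 'a"
    and I :: "'i set" and e :: "'i \<Rightarrow> 'a"
  assumes cell: "cellular_algebra scale po \<Lambda> T c star"
    and A1: "finite I"
    and A2_sum: "(\<Sum>i\<in>I. e i) = 1"
    and A2_nz: "\<forall>i\<in>I. e i \<noteq> 0"
    and A2_idem: "\<forall>i\<in>I. e i * e i = e i"
    and A2_orth: "\<forall>i\<in>I. \<forall>j\<in>I. i \<noteq> j \<longrightarrow> e i * e j = 0"
    and A3: "\<forall>la\<in>\<Lambda>. \<forall>t\<in>T la. \<exists>i\<in>I. \<forall>s\<in>T la. e i * c la t s = c la t s"
    and A4: "\<forall>i\<in>I. star (e i) = e i"
  shows "semisimple_ring_on (UNIV :: 'a set) \<longleftrightarrow> (\<forall>i\<in>I. semisimple_ring_on (corner (e i)))"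
proof
  assume "semisimple_ring_on (UNIV :: 'a set)"
  then show "\<forall>i\<in>I. semisimple_ring_on (corner (e i))"
    using semisimple_corner_of_semisimple A2_idem by blast
next
  assume ss: "\<forall>i\<in>I. semisimple_ring_on (corner (e i))"
  interpret cellular scale po \<Lambda> T c star by unfold_locales (rule cell)
  show "semisimple_ring_on (UNIV :: 'a set)"
  proof (rule semisimple_if_semiprime)
    fix x :: 'a assume xx: "\<And>a. x * a * x = 0"
    \<comment> \<open>Each Peirce component inherits the condition on \<open>x\<close>, because the
      factors \<open>e k\<close> and \<open>e j\<close> around \<open>a\<close> are absorbed into
      the middle of \<open>x * _ * x\<close>.\<close>
    have "e j * x * e k = 0" if j: "j \<in> I" and k: "k \<in> I" for j k
    proof (rule peirce_component_zero[OF A2_idem A2_orth A3 A4 ss j k])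
      show "e j * (e j * x * e k) = e j * x * e k"
        using A2_idem j by (simp add: mult.assoc[symmetric])
      show "e j * x * e k * e k = e j * x * e k"
        using A2_idem k by (simp add: mult.assoc)
      fix a
      have "e j * x * e k * a * (e j * x * e k) = e j * (x * (e k * a * e j) * x) * e k"
        by (simp add: mult.assoc)
      then show "e j * x * e k * a * (e j * x * e k) = 0" using xx by simp
    qed
    moreover have "x = (\<Sum>j\<in>I. e j) * x * (\<Sum>k\<in>I. e k)" by (simp add: A2_sum)
    ultimately show "x = 0" by (simp add: sum_distrib_left sum_distrib_right)
  qed
qed

end
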